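(* Let $n\ge 1$, let $\sigma$ be a uniformly random permutation of $\{1,\ldots,n\}$, and for $1 \leq i \leq n$ let $X_i = X_i(\sigma)$ equal $1$ if $i$ is a fixed point of $\sigma$ and $0$ otherwise. Let $Y_1,\ldots,Y_n$ be independent Poisson random variables, each with mean $\frac{1}{n}$. Then $$\|\mathcal{L}(X_i : 1 \leq i \leq n) - \mathcal{L}(Y_i : 1 \leq i \leq n)\|_{TV} \leq \frac{4}{n}.$$
   Context: $\mathcal{L}(X_i : 1\le i\le n)$ denotes the joint law of $(X_1,\ldots,X_n)$ on $\{0,1,2,\ldots\}^n$, and similarly for the $Y_i$. The total variation distance is $\|\mu-\nu\|_{TV} = \sup_A |\mu(A)-\nu(A)|$, the supremum being over all measurable sets $A$. *)

theory Defs
  imports "HOL-Probability.Probability" "HOL-Combinatorics.Combinatorics"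
begin

(* Intended for finite measures with sets \<mu> = sets \<nu>; the real supremum is then over a
   bounded, nonempty set. *)
definition tv_dist :: "'a measure \<Rightarrow> 'a measure \<Rightarrow> real" where
  "tv_dist \<mu> \<nu> = (SUP A\<in>sets \<mu>. \<bar>measure \<mu> A - measure \<nu> A\<bar>)"

(* The space {0,1,2,...}^I is the space of extensional functions underlying PiM. *)
definition joint_law :: "'a measure \<Rightarrow> 'i set \<Rightarrow> ('i \<Rightarrow> 'a \<Rightarrow> nat) \<Rightarrow> ('i \<Rightarrow> nat) measure" where
  "joint_law M I Z = distr M (PiM I (\<lambda>_. count_space UNIV)) (\<lambda>\<omega>. \<lambda>i\<in>I. Z i \<omega>)"

definition fixed_point_ind :: "'a \<Rightarrow> ('a \<Rightarrow> 'a) \<Rightarrow> nat" where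
  "fixed_point_ind i p = (if p i = i then 1 else 0)"

end

theory Submission
  imports Defs
begin

text \<open>
  The law of the fixed point indicators lives on the points \<open>1\<^sub>S\<close>, where a set \<open>S\<close> with \<open>k\<close> elements
  has mass \<open>d\<^bsub>n-k\<^esub> (n-k)! / n!\<close> with \<open>d\<^bsub>m\<^esub> = (\<Sum>j\<le>m. (-1)^j / j!) \<le> 1/e + 1/(m+1)!\<close> the proportion of
  derangements, while the Poisson law gives it mass \<open>1 / (e n^k)\<close>. The total variation distance is the
  sum over \<open>S\<close> of the positive part of the difference. The errors \<open>1/(m+1)!\<close> contribute at most
  \<open>2^(n+1) / (n+1)! \<le> 3/n\<close>, and what remains is at most \<open>1 - (1 + 1/n)^n / e \<le> 1/n\<close>.
\<close>

section \<open>Permutations sorted by their fixed points, and derangements\<close>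

lemma sum_Pow_card:
  fixes h :: "nat \<Rightarrow> 'b :: semiring_1"
  assumes "finite A"
  shows "(\<Sum>S\<in>Pow A. h (card S)) = (\<Sum>k\<le>card A. of_nat (card A choose k) * h k)"
proof -
  have "(\<Sum>S\<in>Pow A. h (card S)) = (\<Sum>k\<le>card A. \<Sum>S\<in>{S\<in>Pow A. card S = k}. h (card S))"
    using assms by (intro sum.group [symmetric]) (auto intro: card_mono)
  also have "\<dots> = (\<Sum>k\<le>card A. of_nat (card A choose k) * h k)"
    using assms by (intro sum.cong refl) (simp add: n_subsets)
  finally show ?thesis .
qed

lemma card_eq_sum_card_fibres:
  assumes "finite A" "finite B" "f ` A \<subseteq> B"
  shows "card A = (\<Sum>y\<in>B. card {x\<in>A. f x = y})"
  using sum.group[OF assms, of "\<lambda>_. 1::nat"] by simp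

text \<open>A permutation of \<open>A\<close> that fixes \<open>S\<close> pointwise moves only
  points of \<open>A - S\<close>, hence permutes \<open>A - S\<close>; that no further point is
  fixed makes it a derangement there. This reduces counting by fixed point set to counting
  derangements.\<close>

lemma permutes_fixed_set_eq:
  assumes "S \<subseteq> A"
  shows "{p. p permutes A \<and> {x\<in>A. p x = x} = S}
       = {p. p permutes (A - S) \<and> (\<forall>x\<in>A - S. p x \<noteq> x)}"
proof (intro equalityI subsetI; clarsimp)
  fix p assume "p permutes A" "S = {x\<in>A. p x = x}"
  then show "p permutes (A - {x\<in>A. p x = x})"
    by (auto elim!: permutes_superset)
next
  fix p assume p: "p permutes (A - S)" and "\<forall>x\<in>A - S. p x \<noteq> x"
  moreover have "p x = x" if "x \<in> S" for x
    using permutes_not_in[OF p, of x] that by simp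
  ultimately show "p permutes A \<and> {x\<in>A. p x = x} = S"
    using assms permutes_subset[OF p, of A] by blast
qed

text \<open>Sorting all permutations by their fixed point sets expresses a factorial as a sum of
  derangement numbers over subsets; Moebius inversion on the subset lattice solves for the
  derangement numbers.\<close>

lemma card_derangements:
  assumes "finite S"
  shows "real (card {p. p permutes S \<and> (\<forall>x\<in>S. p x \<noteq> x)})
       = fact (card S) * (\<Sum>j\<le>card S. (-1) ^ j / fact j)"
proof -
  define D where "D T = {p. p permutes T \<and> (\<forall>x\<in>T. p x \<noteq> x)}" for T :: "'a set"
  \<comment> \<open>Stated for every finite \<open>A\<close>, because the inversion uses the
    identity on all finite sets and not only on \<open>S\<close>.\<close>
  have split: "fact (card A) = (\<Sum>T\<in>Pow A. real (card (D T)))" if A: "finite A" for A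
  proof -
    have "card {p. p permutes A}
        = (\<Sum>T\<in>Pow A. card {p\<in>{p. p permutes A}. {x\<in>A. p x = x} = T})"
      using A by (intro card_eq_sum_card_fibres) (auto simp: finite_permutations)
    also have "\<dots> = (\<Sum>T\<in>Pow A. card (D (A - T)))"
      by (intro sum.cong refl) (simp add: permutes_fixed_set_eq D_def)
    also have "\<dots> = (\<Sum>T\<in>Pow A. card (D T))"
      by (rule sum.reindex_bij_witness[of _ "\<lambda>T. A - T" "\<lambda>T. A - T"])
         (auto simp: double_diff)
    finally show ?thesis
      using card_permutations[OF refl A] by (metis of_nat_fact of_nat_sum)
  qed
  let ?n = "card S"
  have "real (card (D S)) = (\<Sum>T\<in>Pow S. (-1) ^ (?n - card T) * fact (card T))"
    by (rule inclusion_exclusion_mobius[OF split assms])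
  also have "\<dots> = (\<Sum>k\<le>?n. real (?n choose k) * ((-1) ^ (?n - k) * fact k))"
    by (rule sum_Pow_card[OF assms, of "\<lambda>k. (-1) ^ (?n - k) * fact k"])
  \<comment> \<open>Substitute \<open>j = ?n - k\<close>: the binomial coefficient times
    \<open>fact k\<close> is \<open>fact ?n / fact j\<close>.\<close>
  also have "\<dots> = (\<Sum>j\<le>?n. fact ?n * ((-1) ^ j / fact j))"
    by (rule sum.reindex_bij_witness[of _ "\<lambda>j. ?n - j" "\<lambda>k. ?n - k"])
       (auto simp: binomial_fact field_simps)
  finally show ?thesis by (simp add: D_def sum_distrib_left)
qed

section \<open>Numerical estimates\<close>

text \<open>Taylor expansion of \<open>exp\<close> at \<open>-1\<close> with Lagrange remainder: the
  intermediate point \<open>t\<close> is negative, so \<open>exp t\<close> is below 1.\<close>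

lemma alternating_exp_sum_le:
  "(\<Sum>j\<le>m. (-1) ^ j / fact j) \<le> exp (-1) + (1 / fact (Suc m) :: real)" (is "?s \<le> _")
proof -
  obtain t :: real where t: "t < 0"
    and "exp (-1) = (\<Sum>j<Suc m. exp 0 / fact j * (-1) ^ j) + exp t / fact (Suc m) * (-1) ^ Suc m"
    using Maclaurin_minus[of "-1" "Suc m" "\<lambda>_. exp" exp] by (auto intro!: derivative_eq_intros)
  then have "?s = exp (-1) + exp t / fact (Suc m) * (-1) ^ m"
    by (simp add: lessThan_Suc_atMost)
  also have "exp t / fact (Suc m) * (-1) ^ m \<le> \<bar>exp t / fact (Suc m) * (-1) ^ m\<bar>"
    by (rule abs_ge_self)
  also have "\<dots> \<le> 1 / fact (Suc m)"
    using t by (auto simp: abs_mult power_abs intro!: divide_right_mono)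
  finally show ?thesis by simp
qed

lemma two_power_le_fact:
  assumes "n \<ge> 2"
  shows "n * 2 ^ Suc n \<le> (3 * fact (Suc n) :: nat)"
  using assms
proof (induction n rule: nat_induct_at_least)
  case base
  show ?case by (simp add: numeral_eq_Suc)
next
  case (Suc n)
  \<comment> \<open>The claim is multiplied by \<open>n\<close> so that the left side of the
    induction hypothesis appears; \<open>n\<close> is cancelled at the end. What remains is
    \<open>2 * (n + 1) \<le> n * (n + 2)\<close>, that is \<open>2 \<le> n * n\<close>, which is why
    the induction starts at 2.\<close>
  have "n * (Suc n * 2 ^ Suc (Suc n)) = 2 * Suc n * (n * 2 ^ Suc n)"
    by (simp only: power_Suc mult_ac)
  also have "\<dots> \<le> 2 * Suc n * (3 * fact (Suc n))"
    using Suc.IH by (rule mult_left_mono) simp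
  also have "\<dots> \<le> (n * (n + 2)) * (3 * fact (Suc n))"
  proof (rule mult_right_mono)
    show "2 * Suc n \<le> n * (n + 2)"
      using mult_le_mono[OF Suc.hyps Suc.hyps] by simp
  qed simp
  also have "\<dots> = n * (3 * fact (Suc (Suc n)))"
    by (simp add: algebra_simps)
  finally show ?case using Suc.hyps by simp
qed

text \<open>From \<open>ln (1 + x) \<ge> x - x * x\<close> at \<open>x = 1 / n\<close>, the compound
  factor divided by e is at least \<open>exp (- 1 / n)\<close>, hence at least
  \<open>1 - 1 / n\<close>.\<close>

lemma one_minus_compound_le:
  assumes "n \<ge> (1::nat)"
  shows "1 - exp (-1) * (1 + 1 / real n) ^ n \<le> 1 / real n"
proof -
  have "1 / real n - (1 / real n)\<^sup>2 \<le> ln (1 + 1 / real n)"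
    using assms by (intro ln_one_plus_pos_lower_bound) auto
  then have "real n * (1 / real n - (1 / real n)\<^sup>2) \<le> real n * ln (1 + 1 / real n)"
    by (rule mult_left_mono) simp
  moreover have "real n * (1 / real n - (1 / real n)\<^sup>2) = 1 - 1 / real n"
    using assms by (simp add: field_simps power2_eq_square)
  ultimately have "exp (- (1 / real n)) \<le> exp (-1 + real n * ln (1 + 1 / real n))"
    by simp
  also have "\<dots> = exp (-1) * (1 + 1 / real n) ^ n"
    using assms by (simp only: exp_add exp_of_nat_mult) (simp add: add_pos_nonneg)
  finally show ?thesis
    using exp_ge_add_one_self[of "- (1 / real n)"] by simp
qed

text \<open>The product of \<open>n choose k\<close> and \<open>fact (n - k) / fact n\<close> is
  \<open>1 / fact k\<close>. The sum therefore splits into the Taylor errors, a partial sum of the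
  series for e divided by e, and a binomial expansion of \<open>(1 + 1 / n) ^ n\<close>.\<close>

lemma sum_excess_le:
  assumes "n \<ge> (1::nat)"
  shows "(\<Sum>k\<le>n. real (n choose k) * (fact (n - k) / fact n * (exp (-1) + 1 / fact (Suc (n - k)))
            - exp (-1) / real n ^ k)) \<le> 4 / real n"
proof -
  have "(\<Sum>k\<le>n. real (n choose k) * (fact (n - k) / fact n * (exp (-1) + 1 / fact (Suc (n - k)))
            - exp (-1) / real n ^ k))
      = (\<Sum>k\<le>n. 1 / (fact k * fact (Suc n - k))
            + exp (-1) * (1 / fact k - real (n choose k) * (1 / real n) ^ k))"
    by (intro sum.cong refl) (simp add: binomial_fact Suc_diff_le power_divide field_simps
          del: fact_Suc)
  also have "\<dots> = (\<Sum>k\<le>n. 1 / (fact k * fact (Suc n - k)))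
      + (exp (-1) * (\<Sum>k\<le>n. 1 / fact k) - exp (-1) * (\<Sum>k\<le>n. real (n choose k) * (1 / real n) ^ k))"
    by (simp add: sum.distrib sum_subtractf sum_distrib_left algebra_simps)
  also have "(\<Sum>k\<le>n. real (n choose k) * (1 / real n) ^ k) = (1 + 1 / real n) ^ n"
    using binomial_ring[of "1 / real n" 1 n] by (simp add: add.commute)
  also have "(\<Sum>k\<le>n. 1 / (fact k * fact (Suc n - k))) \<le> 3 / real n"
  proof -
    \<comment> \<open>Adding the term \<open>k = Suc n\<close> completes row \<open>Suc n\<close> of
      Pascal's triangle, up to the factor \<open>1 / fact (Suc n)\<close>.\<close>
    have "(\<Sum>k\<le>n. 1 / (fact k * fact (Suc n - k) :: real))
        \<le> (\<Sum>k\<le>Suc n. 1 / (fact k * fact (Suc n - k)))"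
      by simp
    also have "\<dots> = (\<Sum>k\<le>Suc n. real (Suc n choose k) / fact (Suc n))"
      by (intro sum.cong refl) (simp add: binomial_fact del: fact_Suc)
    also have "\<dots> = 2 ^ Suc n / fact (Suc n)"
      by (simp only: choose_row_sum flip: sum_divide_distrib of_nat_sum) simp
    also have "\<dots> \<le> 3 / real n"
    \<comment> \<open>At \<open>n = 1\<close> the claim is \<open>2 \<le> 3\<close>;
      \<open>two_power_le_fact\<close> covers the rest.\<close>
    proof (cases "n = 1")
      case False
      then have "n * 2 ^ Suc n \<le> (3 * fact (Suc n) :: nat)"
        using assms by (intro two_power_le_fact) simp
      then have "real (n * 2 ^ Suc n) \<le> real (3 * fact (Suc n))"
        by (rule of_nat_mono)
      then show ?thesis
        using assms by (simp add: field_simps del: fact_Suc power_Suc)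
    qed simp
    finally show ?thesis .
  qed
  also have "exp (-1) * (\<Sum>k\<le>n. 1 / fact k) \<le> (1 :: real)"
  proof -
    have "(\<Sum>k\<le>n. 1 / fact k) \<le> exp (1 :: real)"
      using sum_le_suminf[OF summable_exp[of "1::real"], of "{..n}"]
      by (simp add: exp_def inverse_eq_divide)
    then have "exp (-1) * (\<Sum>k\<le>n. 1 / fact k) \<le> exp (-1) * exp (1 :: real)"
      by (rule mult_left_mono) simp
    then show ?thesis by (simp flip: exp_add)
  qed
  also have "3 / real n + (1 - exp (-1) * (1 + 1 / real n) ^ n) \<le> 4 / real n"
    using one_minus_compound_le[OF assms] by simp
  finally show ?thesis by simp
qed

text \<open>A one-sided bound suffices, since passing to the complement exchanges the two measures.\<close>
lemma tv_dist_le_one_sided: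
  assumes "prob_space \<mu>" "prob_space \<nu>" and sets: "sets \<nu> = sets \<mu>"
    and le: "\<And>A. A \<in> sets \<mu> \<Longrightarrow> measure \<mu> A - measure \<nu> A \<le> c"
  shows "tv_dist \<mu> \<nu> \<le> c"
  unfolding tv_dist_def
proof (rule cSUP_least)
  fix A assume A: "A \<in> sets \<mu>"
  have "measure \<mu> (space \<mu> - A) - measure \<nu> (space \<mu> - A) \<le> c"
    using A by (intro le) auto
  moreover have "measure \<mu> (space \<mu> - A) = 1 - measure \<mu> A"
    "measure \<nu> (space \<mu> - A) = 1 - measure \<nu> A"
    using A sets sets_eq_imp_space_eq[OF sets] prob_space.prob_compl[OF assms(1), of A]
      prob_space.prob_compl[OF assms(2), of A] by simp_all
  ultimately show "\<bar>measure \<mu> A - measure \<nu> A\<bar> \<le> c"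
    using le[OF A] by linarith
qed auto

section \<open>The two joint laws on 0-1 vectors\<close>

lemma restrict_eq_restrict_iff:
  "restrict f I = restrict g I \<longleftrightarrow> (\<forall>i\<in>I. f i = g i)"
  by (metis restrict_apply' restrict_ext)

text \<open>A point of a finite product is the box of its coordinate singletons.\<close>

lemma indicator_point_in_sets:
  assumes "finite I"
  shows "{\<lambda>i\<in>I. if i \<in> S then 1 else 0} \<in> sets (PiM I (\<lambda>_. count_space (UNIV :: nat set)))"
proof -
  have "{\<lambda>i\<in>I. if i \<in> S then 1 else (0::nat)} = PiE I (\<lambda>i. {if i \<in> S then 1 else 0})"
    by (auto simp: PiE_iff extensional_def fun_eq_iff)
  then show ?thesis
    using assms by (auto intro!: sets_PiM_I_finite)
qed

text \<open>The vector of indicators is determined by the set of fixed points, so the permutations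
  whose vector lies in \<open>A\<close> are counted according to that set, each class being a set of
  derangements of the complement.\<close>

lemma joint_law_fixed_points:
  fixes \<sigma> :: "'a \<Rightarrow> 'i \<Rightarrow> 'i"
  assumes I: "finite I"
    and meas: "\<sigma> \<in> M \<rightarrow>\<^sub>M count_space {p. p permutes I}"
    and unif: "distr M (count_space {p. p permutes I}) \<sigma> = uniform_count_measure {p. p permutes I}"
    and A: "A \<in> sets (PiM I (\<lambda>_. count_space UNIV))"
  shows "measure (joint_law M I (\<lambda>i \<omega>. fixed_point_ind i (\<sigma> \<omega>))) A
       = (\<Sum>S | S \<subseteq> I \<and> (\<lambda>i\<in>I. if i \<in> S then 1 else 0) \<in> A.
            fact (card I - card S) / fact (card I) * (\<Sum>j\<le>card I - card S. (-1) ^ j / fact j))"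
proof -
  let ?P = "{p. p permutes I}" and ?x = "\<lambda>S. \<lambda>i\<in>I. if i \<in> S then 1 else (0::nat)"
  let ?X = "\<lambda>p. \<lambda>i\<in>I. fixed_point_ind i p"
  let ?F = "{S. S \<subseteq> I \<and> ?x S \<in> A}"
  have X: "?X \<in> count_space ?P \<rightarrow>\<^sub>M PiM I (\<lambda>_. count_space UNIV)"
    by (rule measurable_restrict) simp
  have "joint_law M I (\<lambda>i \<omega>. fixed_point_ind i (\<sigma> \<omega>))
      = distr (uniform_count_measure ?P) (PiM I (\<lambda>_. count_space UNIV)) ?X"
    unfolding joint_law_def unif[symmetric] using distr_distr[OF X meas] by (simp add: o_def)
  moreover have "?X \<in> uniform_count_measure ?P \<rightarrow>\<^sub>M PiM I (\<lambda>_. count_space UNIV)"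
    using X by (simp cong: measurable_cong_sets add: sets_uniform_count_measure_count_space)
  ultimately have "measure (joint_law M I (\<lambda>i \<omega>. fixed_point_ind i (\<sigma> \<omega>))) A
      = measure (uniform_count_measure ?P) {p\<in>?P. ?X p \<in> A}"
    using A by (simp add: measure_distr space_uniform_count_measure vimage_def Int_def conj_commute)
  also have "\<dots> = real (card {p\<in>?P. ?X p \<in> A}) / fact (card I)"
    using I by (subst measure_uniform_count_measure) (auto simp: finite_permutations card_permutations)
  also have "card {p\<in>?P. ?X p \<in> A}
      = (\<Sum>S\<in>?F. card {p\<in>{p\<in>?P. ?X p \<in> A}. {i\<in>I. p i = i} = S})"
  proof (rule card_eq_sum_card_fibres)
    show "(\<lambda>p. {i\<in>I. p i = i}) ` {p\<in>?P. ?X p \<in> A} \<subseteq> ?F"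
    proof (rule image_subsetI)
      fix p assume p: "p \<in> {p\<in>?P. ?X p \<in> A}"
      have "?x {i\<in>I. p i = i} = ?X p"
        by (simp add: restrict_eq_restrict_iff fixed_point_ind_def)
      with p show "{i\<in>I. p i = i} \<in> ?F" by simp
    qed
  qed (use I in \<open>auto simp: finite_permutations\<close>)
  also have "\<dots> = (\<Sum>S\<in>?F. card {p. p permutes (I - S) \<and> (\<forall>x\<in>I - S. p x \<noteq> x)})"
  proof (intro sum.cong refl)
    fix S assume S: "S \<in> ?F"
    \<comment> \<open>All permutations with fixed point set \<open>S\<close> share the vector
      \<open>?x S\<close>, which lies in \<open>A\<close> by the choice of \<open>S\<close>.\<close>
    have "{p\<in>{p\<in>?P. ?X p \<in> A}. {i\<in>I. p i = i} = S} = {p. p permutes I \<and> {i\<in>I. p i = i} = S}"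
    proof -
      have "?X p = ?x S" if "{i\<in>I. p i = i} = S" for p
        using that by (auto simp: fixed_point_ind_def)
      then show ?thesis using S by auto
    qed
    then show "card {p\<in>{p\<in>?P. ?X p \<in> A}. {i\<in>I. p i = i} = S}
        = card {p. p permutes (I - S) \<and> (\<forall>x\<in>I - S. p x \<noteq> x)}"
      using S by (simp add: permutes_fixed_set_eq)
  qed
  also have "real \<dots> / fact (card I) = (\<Sum>S\<in>?F. fact (card I - card S) / fact (card I)
      * (\<Sum>j\<le>card I - card S. (-1) ^ j / fact j))"
    unfolding of_nat_sum sum_divide_distrib
  proof (intro sum.cong refl)
    fix S assume "S \<in> ?F"
    then have "card (I - S) = card I - card S"
      using I by (auto intro!: card_Diff_subset dest: finite_subset)
    then show "real (card {p. p permutes (I - S) \<and> (\<forall>x\<in>I - S. p x \<noteq> x)}) / fact (card I)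
        = fact (card I - card S) / fact (card I) * (\<Sum>j\<le>card I - card S. (-1) ^ j / fact j)"
      using I by (simp add: card_derangements)
  qed
  finally show ?thesis .
qed

text \<open>By independence the mass is a product of Poisson weights at 0 and 1. Every coordinate
  contributes \<open>exp (- 1 / card I)\<close>, together \<open>exp (-1)\<close> as
  \<open>I\<close> is nonempty, and each coordinate in \<open>S\<close> a further
  \<open>1 / card I\<close>.\<close>

lemma joint_law_poisson_point:
  fixes N :: "'b measure" and Y :: "'i \<Rightarrow> 'b \<Rightarrow> nat"
  assumes I: "finite I" "I \<noteq> {}" and N: "prob_space N"
    and indep: "prob_space.indep_vars N (\<lambda>_. count_space UNIV) Y I"
    and poisson: "\<And>i. i \<in> I \<Longrightarrow>
                    distr N (count_space UNIV) (Y i) = measure_pmf (poisson_pmf (1 / real (card I)))"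
    and S: "S \<subseteq> I"
  shows "measure (joint_law N I Y) {\<lambda>i\<in>I. if i \<in> S then 1 else 0}
       = exp (-1) / real (card I) ^ card S"
proof -
  interpret prob_space N by fact
  let ?x = "\<lambda>i. if i \<in> S then 1 else (0::nat)"
  have card: "0 < card I"
    using I by (simp add: card_gt_0_iff)
  have Y: "Y i \<in> N \<rightarrow>\<^sub>M count_space UNIV" if "i \<in> I" for i
    using indep that by (auto simp: indep_vars_def)
  have pr: "prob (Y i -` {k} \<inter> space N) = pmf (poisson_pmf (1 / real (card I))) k"
    if "i \<in> I" for i k
    using measure_distr[OF Y[OF that], of "{k}"] poisson[OF that] by (simp add: pmf.rep_eq)
  have "measure (joint_law N I Y) {\<lambda>i\<in>I. ?x i}
      = prob ((\<lambda>\<omega>. \<lambda>i\<in>I. Y i \<omega>) -` {\<lambda>i\<in>I. ?x i} \<inter> space N)"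
    unfolding joint_law_def
    by (intro measure_distr measurable_restrict Y indicator_point_in_sets I)
  also have "(\<lambda>\<omega>. \<lambda>i\<in>I. Y i \<omega>) -` {\<lambda>i\<in>I. ?x i} \<inter> space N
      = (\<Inter>i\<in>I. Y i -` {?x i} \<inter> space N)"
    using I by (auto simp: restrict_eq_restrict_iff)
  also have "prob \<dots> = (\<Prod>i\<in>I. prob (Y i -` {?x i} \<inter> space N))"
    using I by (intro indep_varsD_finite[OF indep]) auto
  also have "\<dots> = (\<Prod>i\<in>I. (if i \<in> S then 1 / real (card I) else 1) * exp (- 1 / real (card I)))"
    by (intro prod.cong refl) (simp only: pr, simp add: card)
  also have "\<dots> = (\<Prod>i\<in>I. if i \<in> S then 1 / real (card I) else 1) * exp (-1)"
    using I by (simp add: prod.distrib flip: exp_of_nat_mult)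
  also have "\<dots> = exp (-1) / real (card I) ^ card S"
    using S I by (simp add: prod.If_cases Int_absorb1 power_divide)
  finally show ?thesis .
qed

section \<open>Comparison of the two laws\<close>

theorem theorem11:
  fixes n :: nat
    and M :: "'a measure" and \<sigma> :: "'a \<Rightarrow> nat \<Rightarrow> nat"
    and N :: "'b measure" and Y :: "nat \<Rightarrow> 'b \<Rightarrow> nat"
  assumes n: "n \<ge> 1"
    and M: "prob_space M"
    and \<sigma>_meas: "\<sigma> \<in> M \<rightarrow>\<^sub>M count_space {p. p permutes {1..n}}"
    and \<sigma>_unif: "distr M (count_space {p. p permutes {1..n}}) \<sigma>
                    = uniform_count_measure {p. p permutes {1..n}}"
    and N: "prob_space N"
    and Y_indep: "prob_space.indep_vars N (\<lambda>_. count_space UNIV) Y {1..n}"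
    and Y_poisson: "\<And>i. i \<in> {1..n} \<Longrightarrow>
                    distr N (count_space UNIV) (Y i) = measure_pmf (poisson_pmf (1 / real n))"
  shows "tv_dist (joint_law M {1..n} (\<lambda>i \<omega>. fixed_point_ind i (\<sigma> \<omega>))) (joint_law N {1..n} Y)
           \<le> 4 / real n"
proof (rule tv_dist_le_one_sided)
  have X: "(\<lambda>\<omega>. fixed_point_ind i (\<sigma> \<omega>)) \<in> M \<rightarrow>\<^sub>M count_space UNIV" for i
    by (rule measurable_compose[OF \<sigma>_meas]) simp
  show "prob_space (joint_law M {1..n} (\<lambda>i \<omega>. fixed_point_ind i (\<sigma> \<omega>)))"
    unfolding joint_law_def by (intro prob_space.prob_space_distr[OF M] measurable_restrict X)
  have Y: "Y i \<in> N \<rightarrow>\<^sub>M count_space UNIV" if "i \<in> {1..n}" for i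
    using Y_indep that by (auto simp: prob_space.indep_vars_def[OF N])
  show prob_Y: "prob_space (joint_law N {1..n} Y)"
    unfolding joint_law_def by (intro prob_space.prob_space_distr[OF N] measurable_restrict Y)
  show "sets (joint_law N {1..n} Y) = sets (joint_law M {1..n} (\<lambda>i \<omega>. fixed_point_ind i (\<sigma> \<omega>)))"
    by (simp add: joint_law_def)
  fix A assume "A \<in> sets (joint_law M {1..n} (\<lambda>i \<omega>. fixed_point_ind i (\<sigma> \<omega>)))"
  then have A: "A \<in> sets (PiM {1..n} (\<lambda>_. count_space (UNIV :: nat set)))"
    by (simp add: joint_law_def)
  let ?x = "\<lambda>S. \<lambda>i\<in>{1..n}. if i \<in> S then 1 else (0::nat)"
  define F where "F = {S. S \<subseteq> {1..n} \<and> ?x S \<in> A}"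
  have F: "F \<subseteq> Pow {1..n}" by (auto simp: F_def)
  then have fin: "finite F" by (rule finite_subset) simp
  interpret Y: prob_space "joint_law N {1..n} Y" by (rule prob_Y)
  \<comment> \<open>\<open>?b k\<close> bounds the excess of the fixed point law over the Poisson
    law at the indicator of a set with \<open>k\<close> elements.\<close>
  let ?b = "\<lambda>k. fact (n - k) / fact n * (exp (-1) + 1 / fact (Suc (n - k))) - exp (-1) / real n ^ k"
  \<comment> \<open>The falling factorial \<open>n! / (n - k)!\<close> is at most
    \<open>n ^ k\<close>. Nonnegativity later allows the sum over \<open>F\<close> to be enlarged to
    all subsets, which removes the dependence on \<open>A\<close>.\<close>
  have b_nonneg: "0 \<le> ?b k" if "k \<le> n" for k
  proof -
    have "fact n = fact (n - k) * (fact n div fact (n - k) :: nat)"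
      by (rule dvd_mult_div_cancel[symmetric]) (rule fact_dvd, simp)
    also have "\<dots> \<le> fact (n - k) * n ^ k"
      using fact_div_fact_le_pow[OF that] by (rule mult_left_mono) simp
    finally have "real (fact n) \<le> real (fact (n - k) * n ^ k)"
      by (rule of_nat_mono)
    then have "exp (-1) / real n ^ k \<le> fact (n - k) / fact n * exp (-1)"
      using n by (simp add: field_simps)
    also have "\<dots> \<le> fact (n - k) / fact n * (exp (-1) + 1 / fact (Suc (n - k)))"
      by (intro mult_left_mono) simp_all
    finally show ?thesis by simp
  qed
  \<comment> \<open>The Poisson law also charges vectors with entries above 1. Since its mass on
    \<open>A\<close> is subtracted, a lower bound from the 0-1 points of \<open>A\<close> is
    enough.\<close>
  have "(\<Sum>S\<in>F. exp (-1) / real n ^ card S)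
      = (\<Sum>S\<in>F. measure (joint_law N {1..n} Y) {?x S})"
    using joint_law_poisson_point[OF _ _ N Y_indep] Y_poisson n
    by (intro sum.cong refl) (simp add: F_def)
  also have "\<dots> = measure (joint_law N {1..n} Y) (\<Union>S\<in>F. {?x S})"
  proof (rule Y.finite_measure_finite_Union[symmetric])
    show "(\<lambda>S. {?x S}) ` F \<subseteq> Y.events"
      by (auto simp: joint_law_def intro!: indicator_point_in_sets)
    \<comment> \<open>Restricted indicators determine \<open>S\<close> because the members of
      \<open>F\<close> are subsets of \<open>{1..n}\<close>.\<close>
    have "S = T" if "S \<in> F" "T \<in> F" "?x S = ?x T" for S T
    proof (rule set_eqI)
      fix i
      have "i \<in> {1..n} \<Longrightarrow> i \<in> S \<longleftrightarrow> i \<in> T"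
        using that(3) by (auto simp: restrict_eq_restrict_iff split: if_splits)
      then show "i \<in> S \<longleftrightarrow> i \<in> T"
        using that(1,2) by (auto simp: F_def)
    qed
    then show "disjoint_family_on (\<lambda>S. {?x S}) F"
      by (auto simp: disjoint_family_on_def)
  qed (rule fin)
  also have "\<dots> \<le> measure (joint_law N {1..n} Y) A"
    using A by (intro Y.finite_measure_mono) (auto simp: F_def joint_law_def)
  finally have "measure (joint_law M {1..n} (\<lambda>i \<omega>. fixed_point_ind i (\<sigma> \<omega>))) A
      - measure (joint_law N {1..n} Y) A
    \<le> (\<Sum>S\<in>F. fact (n - card S) / fact n * (\<Sum>j\<le>n - card S. (-1) ^ j / fact j)
          - exp (-1) / real n ^ card S)"
    using joint_law_fixed_points[OF _ \<sigma>_meas \<sigma>_unif A] by (simp add: F_def sum_subtractf)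
  also have "\<dots> \<le> (\<Sum>S\<in>F. ?b (card S))"
    by (intro sum_mono diff_right_mono mult_left_mono alternating_exp_sum_le) simp
  also have "\<dots> \<le> (\<Sum>S\<in>Pow {1..n}. ?b (card S))"
  proof (rule sum_mono2[OF _ F])
    fix S assume "S \<in> Pow {1..n} - F"
    then have "card S \<le> n"
      using card_mono[of "{1..n}" S] by simp
    then show "0 \<le> ?b (card S)" by (rule b_nonneg)
  qed simp
  also have "\<dots> = (\<Sum>k\<le>n. real (n choose k) * ?b k)"
    using sum_Pow_card[of "{1..n}" ?b] by simp
  also have "\<dots> \<le> 4 / real n"
    by (rule sum_excess_le[OF n])
  finally show "measure (joint_law M {1..n} (\<lambda>i \<omega>. fixed_point_ind i (\<sigma> \<omega>))) A
      - measure (joint_law N {1..n} Y) A \<le> 4 / real n" .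
qed

end
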